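(* Let $(A, \prec_{\Omega}, \succ_{\Omega}, p)$ be a matching Hom-dendriform algebra. Then $(A, \ast_{\Omega}, p)$ is a matching Hom-preLie algebra, where $$\ast_{\omega}: A \otimes A \rightarrow A, \quad x \ast_{\omega}y :=x \succ_{\omega}y-y \prec_{\omega} x \quad \text{for } x,y \in A \text{ and } \omega \in \Omega.$$
   Context: Let $\mathbf{k}$ be a unitary commutative ring, the base ring of all modules and linear maps, and let $\Omega$ be a nonempty set; a subscript $\Omega$ denotes a family indexed by $\Omega$. A matching Hom-dendriform algebra $(A,\prec_\Omega,\succ_\Omega,p)$ is a $\mathbf{k}$-module $A$ with bilinear operations $\prec_\omega,\succ_\omega: A\otimes A\to A$ ($\omega\in\Omega$) and a linear map $p:A\to A$ such that for all $x,y,z\in A$, $\alpha,\beta\in\Omega$: $$(x \prec_{\alpha} y) \prec_{\beta} p(z)= p(x) \prec_{\alpha} (y \prec_{\beta} z)+ p(x) \prec_{\beta} (y \succ_{\alpha} z),$$ $$(x \succ_{\alpha} y) \prec_{\beta} p(z)= p(x) \succ_{\alpha} (y \prec_{\beta} z),$$ $$(x \prec_{\beta} y) \succ_{\alpha} p(z)+ (x \succ_{\alpha} y) \succ_{\beta} p(z) = p(x) \succ_{\alpha} (y \succ_{\beta} z).$$ A matching Hom-preLie algebra $(A,\ast_\Omega,p)$ is a $\mathbf{k}$-module $A$ with bilinear operations $\ast_{\omega}: A \otimes A \rightarrow A$ ($\omega \in \Omega$) and a linear map $p: A \rightarrow A$ such that for all $x,y,z\in A$, $\alpha,\beta\in\Omega$: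 $$p(x) \ast_{\alpha} (y \ast_{\beta} z)-(x \ast_{\alpha} y) \ast_{\beta} p(z)=p(y) \ast_{\beta}(x \ast_{\alpha} z)-(y \ast_{\beta} x)\ast_{\alpha} p(z).$$ *)

theory Defs
  imports "HOL-Algebra.Module"
begin

definition module_linear ::
    "('k, 'm) ring_scheme \<Rightarrow> ('k, 'a, 'n) module_scheme \<Rightarrow> ('a \<Rightarrow> 'a) \<Rightarrow> bool" where
  "module_linear R A f \<longleftrightarrow>
     f \<in> carrier A \<rightarrow> carrier A \<and>
     (\<forall>x\<in>carrier A. \<forall>y\<in>carrier A. f (x \<oplus>\<^bsub>A\<^esub> y) = f x \<oplus>\<^bsub>A\<^esub> f y) \<and>
     (\<forall>c\<in>carrier R. \<forall>x\<in>carrier A. f (c \<odot>\<^bsub>A\<^esub> x) = c \<odot>\<^bsub>A\<^esub> f x)"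

text \<open>A linear map from the tensor square of \<open>A\<close> to \<open>A\<close> is represented by the bilinear map
  on pairs that it corresponds to.\<close>

definition module_bilinear ::
    "('k, 'm) ring_scheme \<Rightarrow> ('k, 'a, 'n) module_scheme \<Rightarrow> ('a \<Rightarrow> 'a \<Rightarrow> 'a) \<Rightarrow> bool" where
  "module_bilinear R A f \<longleftrightarrow>
     (\<forall>x\<in>carrier A. module_linear R A (\<lambda>y. f x y)) \<and>
     (\<forall>y\<in>carrier A. module_linear R A (\<lambda>x. f x y))"

text \<open>In the two locales below the index comes first: \<open>prec \<alpha> x y\<close> is
  \<open>x \<prec>\<^sub>\<alpha> y\<close>, \<open>succ \<alpha> x y\<close> is \<open>x \<succ>\<^sub>\<alpha> y\<close>, and
  \<open>star \<alpha> x y\<close> is \<open>x \<star>\<^sub>\<alpha> y\<close>. Only their values at indices in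
  \<open>\<Omega>\<close> and arguments in the carrier matter.\<close>

locale matching_hom_dendriform_algebra = module R A
  for R :: "('k, 'm) ring_scheme" (structure)
    and A :: "('k, 'a, 'n) module_scheme" (structure) +
  fixes \<Omega> :: "'w set"
    and prec succ :: "'w \<Rightarrow> 'a \<Rightarrow> 'a \<Rightarrow> 'a"
    and p :: "'a \<Rightarrow> 'a"
  assumes prec_bilinear: "\<omega> \<in> \<Omega> \<Longrightarrow> module_bilinear R A (prec \<omega>)"
    and succ_bilinear: "\<omega> \<in> \<Omega> \<Longrightarrow> module_bilinear R A (succ \<omega>)"
    and p_linear: "module_linear R A p"
    and prec_prec:
      "\<lbrakk>\<alpha> \<in> \<Omega>; \<beta> \<in> \<Omega>; x \<in> carrier A; y \<in> carrier A; z \<in> carrier A\<rbrakk> \<Longrightarrow>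
        prec \<beta> (prec \<alpha> x y) (p z) =
          prec \<alpha> (p x) (prec \<beta> y z) \<oplus>\<^bsub>A\<^esub> prec \<beta> (p x) (succ \<alpha> y z)"
    and succ_prec:
      "\<lbrakk>\<alpha> \<in> \<Omega>; \<beta> \<in> \<Omega>; x \<in> carrier A; y \<in> carrier A; z \<in> carrier A\<rbrakk> \<Longrightarrow>
        prec \<beta> (succ \<alpha> x y) (p z) = succ \<alpha> (p x) (prec \<beta> y z)"
    and succ_succ:
      "\<lbrakk>\<alpha> \<in> \<Omega>; \<beta> \<in> \<Omega>; x \<in> carrier A; y \<in> carrier A; z \<in> carrier A\<rbrakk> \<Longrightarrow>
        succ \<alpha> (prec \<beta> x y) (p z) \<oplus>\<^bsub>A\<^esub> succ \<beta> (succ \<alpha> x y) (p z) =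
          succ \<alpha> (p x) (succ \<beta> y z)"

locale matching_hom_preLie_algebra = module R A
  for R :: "('k, 'm) ring_scheme" (structure)
    and A :: "('k, 'a, 'n) module_scheme" (structure) +
  fixes \<Omega> :: "'w set"
    and star :: "'w \<Rightarrow> 'a \<Rightarrow> 'a \<Rightarrow> 'a"
    and p :: "'a \<Rightarrow> 'a"
  assumes star_bilinear: "\<omega> \<in> \<Omega> \<Longrightarrow> module_bilinear R A (star \<omega>)"
    and p_linear: "module_linear R A p"
    and preLie:
      "\<lbrakk>\<alpha> \<in> \<Omega>; \<beta> \<in> \<Omega>; x \<in> carrier A; y \<in> carrier A; z \<in> carrier A\<rbrakk> \<Longrightarrow>
        star \<alpha> (p x) (star \<beta> y z) \<ominus>\<^bsub>A\<^esub> star \<beta> (star \<alpha> x y) (p z) =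
          star \<beta> (p y) (star \<alpha> x z) \<ominus>\<^bsub>A\<^esub> star \<alpha> (star \<beta> y x) (p z)"

end

theory Submission
  imports Defs
begin

text \<open>
  Write \<open>x \<star>\<^sub>\<omega> y = x \<succ>\<^sub>\<omega> y - y \<prec>\<^sub>\<omega> x\<close>. The Hom-preLie identity says that the twisted associator
  \<open>p(x) \<star>\<^sub>\<alpha> (y \<star>\<^sub>\<beta> z) - (x \<star>\<^sub>\<alpha> y) \<star>\<^sub>\<beta> p(z)\<close> does not change when \<open>(x, \<alpha>)\<close> and \<open>(y, \<beta>)\<close> are
  exchanged. By bilinearity it is a signed sum of eight dendriform monomials. The third dendriform
  axiom, applied to \<open>x, y, z\<close>, cancels \<open>(x \<succ>\<^sub>\<alpha> y) \<succ>\<^sub>\<beta> p(z)\<close>; the first, applied to \<open>z, y, x\<close>,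
  cancels \<open>p(z) \<prec>\<^sub>\<beta> (y \<prec>\<^sub>\<alpha> x)\<close>; the second rewrites \<open>(y \<succ>\<^sub>\<beta> z) \<prec>\<^sub>\<alpha> p(x)\<close> as
  \<open>p(y) \<succ>\<^sub>\<beta> (z \<prec>\<^sub>\<alpha> x)\<close>. What is left consists of three pairs of monomials, and the exchange swaps
  the members of each pair:
  \<open>(x \<prec>\<^sub>\<beta> y) \<succ>\<^sub>\<alpha> p(z) + (y \<prec>\<^sub>\<alpha> x) \<succ>\<^sub>\<beta> p(z)\<close>,
  \<open>p(z) \<prec>\<^sub>\<beta> (x \<succ>\<^sub>\<alpha> y) + p(z) \<prec>\<^sub>\<alpha> (y \<succ>\<^sub>\<beta> x)\<close> and
  \<open>- p(x) \<succ>\<^sub>\<alpha> (z \<prec>\<^sub>\<beta> y) - p(y) \<succ>\<^sub>\<beta> (z \<prec>\<^sub>\<alpha> x)\<close>.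
  The lemma \<open>associator_eq\<close> carries out this computation.
\<close>

context module
begin

lemma module_linear_closed:
  "module_linear R M f \<Longrightarrow> x \<in> carrier M \<Longrightarrow> f x \<in> carrier M"
  by (auto simp: module_linear_def)

lemma module_linear_diff:
  assumes f: "module_linear R M f" and x: "x \<in> carrier M" and y: "y \<in> carrier M"
  shows "f (x \<ominus>\<^bsub>M\<^esub> y) = f x \<ominus>\<^bsub>M\<^esub> f y"
proof -
  have fx: "f x \<in> carrier M" and fy: "f y \<in> carrier M" and fd: "f (x \<ominus>\<^bsub>M\<^esub> y) \<in> carrier M"
    using f x y by (simp_all add: module_linear_closed)
  have "x = (x \<ominus>\<^bsub>M\<^esub> y) \<oplus>\<^bsub>M\<^esub> y"
    using x y by (simp add: M.minus_eq M.a_assoc M.l_neg)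
  then have "f x = f (x \<ominus>\<^bsub>M\<^esub> y) \<oplus>\<^bsub>M\<^esub> f y"
    using f x y by (metis M.minus_closed module_linear_def)
  then show ?thesis
    using fd fy by (simp add: M.minus_eq M.a_assoc M.r_neg)
qed

lemma module_linear_minus:
  assumes f: "module_linear R M f" and g: "module_linear R M g"
  shows "module_linear R M (\<lambda>x. f x \<ominus>\<^bsub>M\<^esub> g x)"
proof -
  have f_closed: "\<And>x. x \<in> carrier M \<Longrightarrow> f x \<in> carrier M"
    and g_closed: "\<And>x. x \<in> carrier M \<Longrightarrow> g x \<in> carrier M"
    using f g by (simp_all add: module_linear_closed)
  have "f (x \<oplus>\<^bsub>M\<^esub> y) \<ominus>\<^bsub>M\<^esub> g (x \<oplus>\<^bsub>M\<^esub> y) = (f x \<ominus>\<^bsub>M\<^esub> g x) \<oplus>\<^bsub>M\<^esub> (f y \<ominus>\<^bsub>M\<^esub> g y)"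
    if "x \<in> carrier M" "y \<in> carrier M" for x y
    using f g that f_closed g_closed
    by (simp add: module_linear_def M.minus_eq M.minus_add M.a_ac)
  moreover have "f (c \<odot>\<^bsub>M\<^esub> x) \<ominus>\<^bsub>M\<^esub> g (c \<odot>\<^bsub>M\<^esub> x) = c \<odot>\<^bsub>M\<^esub> (f x \<ominus>\<^bsub>M\<^esub> g x)"
    if "c \<in> carrier R" "x \<in> carrier M" for c x
    using f g that f_closed g_closed
    by (simp add: module_linear_def M.minus_eq smult_r_distr smult_r_minus)
  ultimately show ?thesis
    using f_closed g_closed by (simp add: module_linear_def)
qed

lemma module_bilinear_minus_flip:
  assumes "module_bilinear R M f" and "module_bilinear R M g"
  shows "module_bilinear R M (\<lambda>x y. f x y \<ominus>\<^bsub>M\<^esub> g y x)"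
  using assms by (simp add: module_bilinear_def module_linear_minus)

lemma module_bilinear_closed:
  "module_bilinear R M f \<Longrightarrow> x \<in> carrier M \<Longrightarrow> y \<in> carrier M \<Longrightarrow> f x y \<in> carrier M"
  unfolding module_bilinear_def using module_linear_closed by blast

lemma module_bilinear_diff_left:
  "module_bilinear R M f \<Longrightarrow> x \<in> carrier M \<Longrightarrow> y \<in> carrier M \<Longrightarrow> z \<in> carrier M \<Longrightarrow>
    f (x \<ominus>\<^bsub>M\<^esub> y) z = f x z \<ominus>\<^bsub>M\<^esub> f y z"
  unfolding module_bilinear_def using module_linear_diff[of "\<lambda>x. f x z"] by blast

lemma module_bilinear_diff_right:
  "module_bilinear R M f \<Longrightarrow> x \<in> carrier M \<Longrightarrow> y \<in> carrier M \<Longrightarrow> z \<in> carrier M \<Longrightarrow>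
    f x (y \<ominus>\<^bsub>M\<^esub> z) = f x y \<ominus>\<^bsub>M\<^esub> f x z"
  unfolding module_bilinear_def using module_linear_diff[of "f x"] by blast

text \<open>The cancellation between the two halves of the associator: the third axiom makes
  \<open>a \<oplus> b\<close> from \<open>p(x) \<succ>\<^sub>\<alpha> (y \<succ>\<^sub>\<beta> z)\<close> and the first makes \<open>e \<oplus> g\<close> from \<open>(z \<prec>\<^sub>\<beta> y) \<prec>\<^sub>\<alpha> p(x)\<close>,
  and \<open>b\<close>, \<open>e\<close> occur again in the second half.\<close>

lemma cancel_common_terms:
  assumes "a \<in> carrier M" "b \<in> carrier M" "c \<in> carrier M" "d \<in> carrier M"
    "e \<in> carrier M" "g \<in> carrier M" "h \<in> carrier M" "k \<in> carrier M"
  shows "(((a \<oplus>\<^bsub>M\<^esub> b) \<ominus>\<^bsub>M\<^esub> c) \<ominus>\<^bsub>M\<^esub> (d \<ominus>\<^bsub>M\<^esub> (e \<oplus>\<^bsub>M\<^esub> g))) \<ominus>\<^bsub>M\<^esub> ((b \<ominus>\<^bsub>M\<^esub> h) \<ominus>\<^bsub>M\<^esub> (k \<ominus>\<^bsub>M\<^esub> e)) =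
    ((a \<oplus>\<^bsub>M\<^esub> h) \<oplus>\<^bsub>M\<^esub> (k \<oplus>\<^bsub>M\<^esub> g)) \<ominus>\<^bsub>M\<^esub> (c \<oplus>\<^bsub>M\<^esub> d)"
    (is "?lhs = ?rhs")
proof -
  \<comment> \<open>Sorting the summands separates \<open>b\<close> from its negative, so that they cannot cancel on the left;
    with the cancelling pairs restored on the right, both sides have the same sorted form.\<close>
  have "?lhs = ?rhs \<oplus>\<^bsub>M\<^esub> ((b \<oplus>\<^bsub>M\<^esub> \<ominus>\<^bsub>M\<^esub> b) \<oplus>\<^bsub>M\<^esub> (e \<oplus>\<^bsub>M\<^esub> \<ominus>\<^bsub>M\<^esub> e))"
    using assms by (simp add: M.minus_eq M.minus_add M.a_ac del: M.r_neg M.l_neg)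
  also have "\<dots> = ?rhs"
    using assms by (simp add: M.r_neg)
  finally show ?thesis .
qed

end

context matching_hom_dendriform_algebra
begin

abbreviation star :: "'w \<Rightarrow> 'a \<Rightarrow> 'a \<Rightarrow> 'a"
  where "star \<omega> x y \<equiv> succ \<omega> x y \<ominus>\<^bsub>A\<^esub> prec \<omega> y x"

text \<open>Every bracket on the right-hand side, up to commutativity of addition, is invariant under
  exchanging \<open>(x, \<alpha>)\<close> with \<open>(y, \<beta>)\<close>; this is the reason for the chosen grouping.\<close>

lemma associator_eq:
  assumes \<alpha>: "\<alpha> \<in> \<Omega>" and \<beta>: "\<beta> \<in> \<Omega>"
    and x: "x \<in> carrier A" and y: "y \<in> carrier A" and z: "z \<in> carrier A"
  shows "star \<alpha> (p x) (star \<beta> y z) \<ominus>\<^bsub>A\<^esub> star \<beta> (star \<alpha> x y) (p z) =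
    ((succ \<alpha> (prec \<beta> x y) (p z) \<oplus>\<^bsub>A\<^esub> succ \<beta> (prec \<alpha> y x) (p z)) \<oplus>\<^bsub>A\<^esub>
      (prec \<beta> (p z) (succ \<alpha> x y) \<oplus>\<^bsub>A\<^esub> prec \<alpha> (p z) (succ \<beta> y x))) \<ominus>\<^bsub>A\<^esub>
    (succ \<alpha> (p x) (prec \<beta> z y) \<oplus>\<^bsub>A\<^esub> succ \<beta> (p y) (prec \<alpha> z x))"
proof -
  note p_closed = module_linear_closed[OF p_linear]
  note closed = module_bilinear_closed[OF prec_bilinear] module_bilinear_closed[OF succ_bilinear]
    p_closed
  note diff = module_bilinear_diff_left[OF prec_bilinear] module_bilinear_diff_left[OF succ_bilinear]
    module_bilinear_diff_right[OF prec_bilinear] module_bilinear_diff_right[OF succ_bilinear]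
  have "star \<alpha> (p x) (star \<beta> y z) =
      ((succ \<alpha> (prec \<beta> x y) (p z) \<oplus>\<^bsub>A\<^esub> succ \<beta> (succ \<alpha> x y) (p z)) \<ominus>\<^bsub>A\<^esub>
        succ \<alpha> (p x) (prec \<beta> z y)) \<ominus>\<^bsub>A\<^esub>
      (succ \<beta> (p y) (prec \<alpha> z x) \<ominus>\<^bsub>A\<^esub>
        (prec \<beta> (p z) (prec \<alpha> y x) \<oplus>\<^bsub>A\<^esub> prec \<alpha> (p z) (succ \<beta> y x)))"
    using assms by (simp add: closed diff prec_prec succ_prec succ_succ)
  moreover have "star \<beta> (star \<alpha> x y) (p z) =
      (succ \<beta> (succ \<alpha> x y) (p z) \<ominus>\<^bsub>A\<^esub> succ \<beta> (prec \<alpha> y x) (p z)) \<ominus>\<^bsub>A\<^esub>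
      (prec \<beta> (p z) (succ \<alpha> x y) \<ominus>\<^bsub>A\<^esub> prec \<beta> (p z) (prec \<alpha> y x))"
    using assms by (simp add: closed diff)
  ultimately show ?thesis
    using assms by (simp add: cancel_common_terms closed)
qed

lemma star_preLie:
  assumes "\<alpha> \<in> \<Omega>" "\<beta> \<in> \<Omega>" "x \<in> carrier A" "y \<in> carrier A" "z \<in> carrier A"
  shows "star \<alpha> (p x) (star \<beta> y z) \<ominus>\<^bsub>A\<^esub> star \<beta> (star \<alpha> x y) (p z) =
    star \<beta> (p y) (star \<alpha> x z) \<ominus>\<^bsub>A\<^esub> star \<alpha> (star \<beta> y x) (p z)"
  using assms
  by (simp add: associator_eq M.a_comm module_bilinear_closed[OF prec_bilinear]
      module_bilinear_closed[OF succ_bilinear] module_linear_closed[OF p_linear])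

end

theorem theorem4p7:
  fixes R :: "('k, 'm) ring_scheme"
    and A :: "('k, 'a, 'n) module_scheme"
    and \<Omega> :: "'w set"
    and prec succ :: "'w \<Rightarrow> 'a \<Rightarrow> 'a \<Rightarrow> 'a"
    and p :: "'a \<Rightarrow> 'a"
  assumes "\<Omega> \<noteq> {}"
    and "matching_hom_dendriform_algebra R A \<Omega> prec succ p"
  shows "matching_hom_preLie_algebra R A \<Omega>
           (\<lambda>\<omega> x y. succ \<omega> x y \<ominus>\<^bsub>A\<^esub> prec \<omega> y x) p"
proof -
  interpret matching_hom_dendriform_algebra R A \<Omega> prec succ p
    by (fact assms(2))
  show ?thesis
    by unfold_locales
      (simp_all add: module_bilinear_minus_flip prec_bilinear succ_bilinear p_linear star_preLie)
qed

end
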